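(* Let $m\ge1$ be an integer and $0<\theta\le1$. Suppose the number of balls is a random variable $N$ taking values in $\{0,1,2,\dots\}$ with probability mass function $p_N$ and probability generating function $G_N(z)=\sum_{n\ge0}p_N(n)z^n$, and that conditionally on $N=n$ the occupancy number $K_N$ has the extended occupancy distribution $\operatorname{Occ}(\cdot\mid n,m,\theta)$. Then for every $k=0,1,\dots,m$ the marginal mass function of the occupancy number is $$\mathbb{P}(K_N=k\mid m,\theta)=\binom mk\sum_{i=0}^{k}\binom ki(-1)^{k-i}\,G_N\Big(1-\theta\cdot\frac{m-i}{m}\Big).$$
   Context: Noncentral Stirling numbers of the second kind: for an integer $n\ge0$ and real $\phi$, the numbers $S(n,k,\phi)$, $0\le k\le n$, are defined by the polynomial identity $(x+\phi)^n=\sum_{k=0}^n S(n,k,\phi)(x)_k$, where $(x)_k=\prod_{i=0}^{k-1}(x-i)$; $S(n,k,\phi)=0$ for $k>n$. Convention $0^0=1$. Extended occupancy distribution: for integers $n\ge0$, $m\ge1$, $k\ge0$ and $0<\theta\le1$, $\operatorname{Occ}(k\mid n,m,\theta)=\frac{\theta^n}{m^n}(m)_k\,S\big(n,k,m\tfrac{1-\theta}{\theta}\big)$. *)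

theory Defs
  imports "HOL-Probability.Probability"
begin

definition falling_factorial :: "real \<Rightarrow> nat \<Rightarrow> real" where
  "falling_factorial x k = (\<Prod>i<k. x - real i)"

lemma falling_factorial_0 [simp]: "falling_factorial x 0 = 1"
  by (simp add: falling_factorial_def)

lemma falling_factorial_Suc: "falling_factorial x (Suc k) = falling_factorial x k * (x - real k)"
  by (simp add: falling_factorial_def)

text \<open>Vanishing above \<open>n\<close> is part of the characterisation, so that the description below
  determines the whole sequence of coefficients.\<close>

definition is_noncentral_stirling :: "nat \<Rightarrow> real \<Rightarrow> (nat \<Rightarrow> real) \<Rightarrow> bool" where
  "is_noncentral_stirling n \<phi> S \<longleftrightarrow>
     (\<forall>x::real. (x + \<phi>) ^ n = (\<Sum>k\<le>n. S k * falling_factorial x k)) \<and> (\<forall>k>n. S k = 0)"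

definition noncentral_stirling :: "nat \<Rightarrow> nat \<Rightarrow> real \<Rightarrow> real" where
  "noncentral_stirling n k \<phi> = (THE S. is_noncentral_stirling n \<phi> S) k"

lemma falling_factorial_eq_0: "j < k \<Longrightarrow> falling_factorial (real j) k = 0"
  unfolding falling_factorial_def by (rule prod_zero) auto

lemma falling_factorial_nz: "falling_factorial (real j) j \<noteq> 0"
  by (auto simp: falling_factorial_def)

lemma falling_factorial_coeffs_unique:
  assumes "\<And>x::real. (\<Sum>k\<le>n. c k * falling_factorial x k) = (\<Sum>k\<le>n. d k * falling_factorial x k)"
    and "j \<le> n"
  shows "c j = d j"
  using \<open>j \<le> n\<close>
proof (induction j rule: less_induct)
  case (less j)
  have split: "(\<Sum>k\<le>n. e k * falling_factorial (real j) k) =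
      e j * falling_factorial (real j) j + (\<Sum>k<j. e k * falling_factorial (real j) k)"
    for e :: "nat \<Rightarrow> real"
  proof -
    have "(\<Sum>k\<le>n. e k * falling_factorial (real j) k) = (\<Sum>k\<le>j. e k * falling_factorial (real j) k)"
      using less.prems by (intro sum.mono_neutral_right) (auto simp: falling_factorial_eq_0)
    also have "{..j} = insert j {..<j}" by auto
    finally show ?thesis by simp
  qed
  have "(\<Sum>k<j. c k * falling_factorial (real j) k) = (\<Sum>k<j. d k * falling_factorial (real j) k)"
    using less by (intro sum.cong) auto
  with assms(1)[of "real j"] have "c j * falling_factorial (real j) j = d j * falling_factorial (real j) j"
    unfolding split by simp
  thus ?case using falling_factorial_nz by simp
qed

lemma is_noncentral_stirling_exists: "\<exists>S. is_noncentral_stirling n \<phi> S"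
proof (induction n)
  case 0
  show ?case
    by (rule exI[of _ "\<lambda>k. if k = 0 then 1 else 0"]) (simp add: is_noncentral_stirling_def)
next
  case (Suc n)
  then obtain S where S: "\<And>x. (x + \<phi>) ^ n = (\<Sum>k\<le>n. S k * falling_factorial x k)"
    and S0: "\<And>k. k > n \<Longrightarrow> S k = 0"
    by (auto simp: is_noncentral_stirling_def)
  define T where "T k = (real k + \<phi>) * S k + (case k of 0 \<Rightarrow> 0 | Suc l \<Rightarrow> S l)" for k
  have "(x + \<phi>) ^ Suc n = (\<Sum>k\<le>Suc n. T k * falling_factorial x k)" for x
  proof -
    have "(x + \<phi>) ^ Suc n = (\<Sum>k\<le>n. (x + \<phi>) * (S k * falling_factorial x k))"
      by (simp add: S sum_distrib_left)
    also have "\<dots> = (\<Sum>k\<le>n. (real k + \<phi>) * S k * falling_factorial x k)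
        + (\<Sum>k\<le>n. S k * falling_factorial x (Suc k))"
      unfolding sum.distrib[symmetric]
      by (intro sum.cong refl) (simp add: falling_factorial_Suc algebra_simps)
    also have "(\<Sum>k\<le>n. (real k + \<phi>) * S k * falling_factorial x k)
        = (\<Sum>k\<le>Suc n. (real k + \<phi>) * S k * falling_factorial x k)"
      by (simp add: S0)
    also have "(\<Sum>k\<le>n. S k * falling_factorial x (Suc k))
        = (\<Sum>k\<le>Suc n. (case k of 0 \<Rightarrow> 0 | Suc l \<Rightarrow> S l) * falling_factorial x k)"
      by (simp add: sum.atMost_Suc_shift del: sum.atMost_Suc)
    finally show ?thesis
      by (simp add: T_def sum.distrib distrib_right)
  qed
  moreover have "\<forall>k>Suc n. T k = 0"
    by (auto simp: T_def S0 split: nat.split)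
  ultimately show ?case
    unfolding is_noncentral_stirling_def by blast
qed

lemma is_noncentral_stirling_ex1: "\<exists>!S. is_noncentral_stirling n \<phi> S"
proof (rule ex_ex1I[OF is_noncentral_stirling_exists])
  fix S T assume ST: "is_noncentral_stirling n \<phi> S" "is_noncentral_stirling n \<phi> T"
  show "S = T"
  proof
    fix k
    show "S k = T k"
    proof (cases "k \<le> n")
      case True
      show ?thesis
        by (rule falling_factorial_coeffs_unique[OF _ True])
           (use ST in \<open>simp add: is_noncentral_stirling_def\<close>)
    next
      case False
      with ST show ?thesis by (simp add: is_noncentral_stirling_def)
    qed
  qed
qed

lemma noncentral_stirling:
  "is_noncentral_stirling n \<phi> (\<lambda>k. noncentral_stirling n k \<phi>)"
  unfolding noncentral_stirling_def using theI'[OF is_noncentral_stirling_ex1[of n \<phi>]] by simp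

definition Occ :: "nat \<Rightarrow> nat \<Rightarrow> nat \<Rightarrow> real \<Rightarrow> real" where
  "Occ k n m \<theta> = \<theta> ^ n / real m ^ n * falling_factorial (real m) k
     * noncentral_stirling n k (real m * ((1 - \<theta>) / \<theta>))"

definition prob_gen_fun :: "'a measure \<Rightarrow> ('a \<Rightarrow> nat) \<Rightarrow> real \<Rightarrow> real" where
  "prob_gen_fun M N z = (\<Sum>n. \<P>(\<omega> in M. N \<omega> = n) * z ^ n)"

end

theory Submission
  imports Defs
begin

text \<open>Newton's difference formula turns the defining identity of the noncentral Stirling numbers into
  \<open>k! S(n,k,\<phi>) = (\<Sum>i\<le>k. (k choose i) (-1)^(k-i) (i + \<phi>)^n)\<close>. With \<open>\<phi> = m (1 - \<theta>) / \<theta>\<close>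
  the factor \<open>(\<theta>/m)^n\<close> turns \<open>(i + \<phi>)^n\<close> into the power
  \<open>(1 - \<theta> (m - i)/m)^n\<close>, so averaging over \<open>N\<close> replaces each power by the generating function.\<close>

lemma falling_factorial_eq_fact_binomial:
  "falling_factorial (real n) k = fact k * real (n choose k)"
  by (simp add: falling_factorial_def binomial_gbinomial gbinomial_prod_rev atLeast0LessThan)

text \<open>Orthogonality behind binomial inversion: trinomial revision pulls out the factor
  \<open>k choose j\<close>, and what remains is the alternating sum of row \<open>k - j\<close> of
  Pascal's triangle, the expansion of \<open>(1 - 1) ^ (k - j)\<close>.\<close>

lemma alternating_sum_choose_mult:
  assumes "j \<le> k"
  shows "(\<Sum>i\<le>k. real (k choose i) * (-1) ^ (k - i) * real (i choose j)) = (if j = k then 1 else 0)"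
proof -
  have "(\<Sum>i\<le>k. real (k choose i) * (-1) ^ (k - i) * real (i choose j))
      = (\<Sum>i\<in>{j..k}. real (k choose j) * (real ((k - j) choose (i - j)) * (-1) ^ (k - i)))"
  proof (rule sum.mono_neutral_cong_right)
    fix i assume "i \<in> {j..k}"
    then have "real (k choose i) * real (i choose j) = real (k choose j) * real ((k - j) choose (i - j))"
      by (simp add: choose_mult flip: of_nat_mult)
    then show "real (k choose i) * (-1) ^ (k - i) * real (i choose j)
        = real (k choose j) * (real ((k - j) choose (i - j)) * (-1) ^ (k - i))"
      by (simp add: algebra_simps)
  qed auto
  also have "\<dots> = (\<Sum>l\<le>k - j. real (k choose j) * (real ((k - j) choose l) * (-1) ^ l))"
    using assms
    by (intro sum.reindex_bij_witness[of _ "\<lambda>l. k - l" "\<lambda>i. k - i"])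
      (auto simp: binomial_symmetric[of "_ - j" "k - j"])
  also have "\<dots> = real (k choose j) * (\<Sum>l\<le>k - j. (-1) ^ l * real ((k - j) choose l))"
    by (simp add: sum_distrib_left mult.commute)
  also have "\<dots> = (if j = k then 1 else 0)"
    using assms choose_alternating_sum[of "k - j", where 'a = real] by auto
  finally show ?thesis .
qed

text \<open>At an integer \<open>x = i\<close> the defining identity is a binomial transform of the
  sequence \<open>S j * fact j\<close>; the orthogonality relation above inverts it.\<close>

lemma noncentral_stirling_explicit:
  "fact k * noncentral_stirling n k \<phi>
    = (\<Sum>i\<le>k. real (k choose i) * (-1) ^ (k - i) * (real i + \<phi>) ^ n)"
proof -
  define S where "S j = noncentral_stirling n j \<phi>" for j
  have S: "(x + \<phi>) ^ n = (\<Sum>j\<le>n. S j * falling_factorial x j)" "l > n \<Longrightarrow> S l = 0" for x l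
    using noncentral_stirling[of n \<phi>] by (auto simp: is_noncentral_stirling_def S_def)
  have *: "(real i + \<phi>) ^ n = (\<Sum>j\<le>k. S j * fact j * real (i choose j))" if "i \<le> k" for i
  proof -
    \<comment> \<open>Passing through \<open>max n k\<close> treats \<open>k \<le> n\<close> and
      \<open>k > n\<close> together: padding uses that \<open>S\<close> vanishes above
      \<open>n\<close>, cutting back to \<open>k\<close> that the falling factorial of
      \<open>i\<close> vanishes above \<open>i\<close>.\<close>
    have "(real i + \<phi>) ^ n = (\<Sum>j\<le>max n k. S j * falling_factorial (real i) j)"
      unfolding S(1) by (rule sum.mono_neutral_left) (auto simp: S(2))
    also have "\<dots> = (\<Sum>j\<le>k. S j * falling_factorial (real i) j)"
      using that by (intro sum.mono_neutral_right) (auto simp: falling_factorial_eq_0)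
    finally show ?thesis
      by (simp add: falling_factorial_eq_fact_binomial mult.assoc)
  qed
  have "(\<Sum>i\<le>k. real (k choose i) * (-1) ^ (k - i) * (real i + \<phi>) ^ n)
      = (\<Sum>i\<le>k. \<Sum>j\<le>k. S j * fact j * (real (k choose i) * (-1) ^ (k - i) * real (i choose j)))"
    by (intro sum.cong refl) (simp add: * sum_distrib_left mult_ac)
  also have "\<dots> = (\<Sum>j\<le>k. S j * fact j *
      (\<Sum>i\<le>k. real (k choose i) * (-1) ^ (k - i) * real (i choose j)))"
    by (subst sum.swap) (simp only: sum_distrib_left)
  also have "\<dots> = (\<Sum>j\<le>k. if j = k then S j * fact j else 0)"
    by (intro sum.cong refl) (simp add: alternating_sum_choose_mult)
  also have "\<dots> = fact k * S k"
    by simp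
  finally show ?thesis by (simp add: S_def)
qed

text \<open>The falling factorial of \<open>m\<close> supplies \<open>fact k * (m choose k)\<close>,
  and its \<open>fact k\<close> is the one needed to apply the explicit Stirling formula.\<close>

lemma Occ_explicit:
  assumes "m \<ge> 1" and "0 < \<theta>"
  shows "Occ k n m \<theta> = real (m choose k) * (\<Sum>i\<le>k. real (k choose i) * (-1) ^ (k - i) *
    (1 - \<theta> * ((real m - real i) / real m)) ^ n)"
proof -
  define \<phi> where "\<phi> = real m * ((1 - \<theta>) / \<theta>)"
  have "\<theta> / real m * (real i + \<phi>) = 1 - \<theta> * ((real m - real i) / real m)" for i
    using assms by (simp add: \<phi>_def field_simps)
  then have pow: "(\<theta> / real m) ^ n * (real i + \<phi>) ^ n
      = (1 - \<theta> * ((real m - real i) / real m)) ^ n" for i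
    by (metis power_mult_distrib)
  have "Occ k n m \<theta> = (\<theta> / real m) ^ n * real (m choose k) * (fact k * noncentral_stirling n k \<phi>)"
    by (simp add: Occ_def \<phi>_def falling_factorial_eq_fact_binomial power_divide)
  also have "\<dots> = real (m choose k) * (\<Sum>i\<le>k. real (k choose i) * (-1) ^ (k - i) *
      ((\<theta> / real m) ^ n * (real i + \<phi>) ^ n))"
    unfolding noncentral_stirling_explicit sum_distrib_left by (simp add: mult_ac)
  finally show ?thesis unfolding pow .
qed

text \<open>Countable additivity over the disjoint level sets of \<open>N\<close>.\<close>

lemma (in prob_space) total_probability_sums:
  assumes [measurable]: "N \<in> measurable M (count_space (UNIV :: nat set))" "Measurable.pred M P"
  shows "(\<lambda>n. \<P>(\<omega> in M. N \<omega> = n) * \<P>(\<omega> in M. P \<omega> \<bar> N \<omega> = n)) sums \<P>(\<omega> in M. P \<omega>)"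
proof -
  have "(\<lambda>n. \<P>(\<omega> in M. P \<omega> \<and> N \<omega> = n)) sums prob (\<Union>n. {\<omega> \<in> space M. P \<omega> \<and> N \<omega> = n})"
    by (intro finite_measure_UNION) (auto simp: disjoint_family_on_def)
  also have "(\<Union>n. {\<omega> \<in> space M. P \<omega> \<and> N \<omega> = n}) = {\<omega> \<in> space M. P \<omega>}"
    by auto
  also have "(\<lambda>n. \<P>(\<omega> in M. P \<omega> \<and> N \<omega> = n))
      = (\<lambda>n. \<P>(\<omega> in M. N \<omega> = n) * \<P>(\<omega> in M. P \<omega> \<bar> N \<omega> = n))"
  proof
    fix n
    \<comment> \<open>On a null level set the conditional probability is a division by zero; this
      bound makes the joint probability vanish too, so the product rule still holds.\<close>
    have "\<P>(\<omega> in M. P \<omega> \<and> N \<omega> = n) \<le> \<P>(\<omega> in M. N \<omega> = n)"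
      by (intro finite_measure_mono) auto
    then show "\<P>(\<omega> in M. P \<omega> \<and> N \<omega> = n)
        = \<P>(\<omega> in M. N \<omega> = n) * \<P>(\<omega> in M. P \<omega> \<bar> N \<omega> = n)"
      by (auto simp: cond_prob_def measure_le_0_iff)
  qed
  finally show ?thesis .
qed

text \<open>The infinite sum defining \<open>prob_gen_fun\<close> is meaningful only once
  convergence is known; the mass function of \<open>N\<close> is a summable majorant on the closed
  unit interval.\<close>

lemma (in prob_space) prob_gen_fun_sums:
  assumes [measurable]: "N \<in> measurable M (count_space UNIV)" and "\<bar>z\<bar> \<le> 1"
  shows "(\<lambda>n. \<P>(\<omega> in M. N \<omega> = n) * z ^ n) sums prob_gen_fun M N z"
proof -
  have "(\<lambda>n. \<P>(\<omega> in M. N \<omega> = n)) sums prob (\<Union>n. {\<omega> \<in> space M. N \<omega> = n})"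
    by (intro finite_measure_UNION) (auto simp: disjoint_family_on_def)
  then have "summable (\<lambda>n. \<P>(\<omega> in M. N \<omega> = n))"
    by (rule sums_summable)
  then have "summable (\<lambda>n. \<P>(\<omega> in M. N \<omega> = n) * z ^ n)"
    by (rule summable_comparison_test'[where N = 0])
      (use assms(2) in \<open>simp add: abs_mult power_abs mult_left_le power_le_one\<close>)
  then show ?thesis
    unfolding prob_gen_fun_def by (rule summable_sums)
qed

theorem theorem11:
  fixes M :: "'a measure" and N K :: "'a \<Rightarrow> nat" and m :: nat and \<theta> :: real
  assumes "m \<ge> 1"
    and "0 < \<theta>" and "\<theta> \<le> 1"
    and "prob_space M"
    and "N \<in> measurable M (count_space UNIV)"
    and "K \<in> measurable M (count_space UNIV)"
    and "\<And>n k. \<P>(\<omega> in M. N \<omega> = n) > 0 \<Longrightarrow>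
           \<P>(\<omega> in M. K \<omega> = k \<bar> N \<omega> = n) = Occ k n m \<theta>"
  shows "\<forall>k\<le>m. \<P>(\<omega> in M. K \<omega> = k) =
           real (m choose k) * (\<Sum>i\<le>k. real (k choose i) * (-1) ^ (k - i) *
             prob_gen_fun M N (1 - \<theta> * ((real m - real i) / real m)))"
proof (intro allI impI)
  fix k assume "k \<le> m"
  interpret prob_space M by fact
  note [measurable] = assms(5,6)
  define z where "z i = 1 - \<theta> * ((real m - real i) / real m)" for i
  define p where "p n = \<P>(\<omega> in M. N \<omega> = n)" for n
  \<comment> \<open>Since \<open>i \<le> k \<le> m\<close>, the number subtracted from 1 lies
    between 0 and 1, so the generating function converges at every \<open>z i\<close>.\<close>
  have "\<bar>z i\<bar> \<le> 1" if "i \<le> k" for i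
  proof -
    have "0 \<le> (real m - real i) / real m" "(real m - real i) / real m \<le> 1"
      using that \<open>k \<le> m\<close> assms(1) by (auto simp: divide_simps)
    then have "0 \<le> \<theta> * ((real m - real i) / real m)" "\<theta> * ((real m - real i) / real m) \<le> 1"
      using assms(2,3) by (simp_all only: mult_nonneg_nonneg mult_le_one less_imp_le)
    then show ?thesis by (auto simp: z_def)
  qed
  then have "(\<lambda>n. real (m choose k) * (\<Sum>i\<le>k. real (k choose i) * (-1) ^ (k - i) * (p n * z i ^ n)))
      sums (real (m choose k) * (\<Sum>i\<le>k. real (k choose i) * (-1) ^ (k - i) * prob_gen_fun M N (z i)))"
    unfolding p_def by (intro sums_mult sums_sum prob_gen_fun_sums) auto
  moreover have "p n * \<P>(\<omega> in M. K \<omega> = k \<bar> N \<omega> = n)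
      = real (m choose k) * (\<Sum>i\<le>k. real (k choose i) * (-1) ^ (k - i) * (p n * z i ^ n))" for n
  \<comment> \<open>The conditional law of \<open>K\<close> is prescribed only where
    \<open>N\<close> has positive mass; elsewhere the factor \<open>p n\<close> annihilates both
    sides.\<close>
  proof (cases "p n > 0")
    case True
    then have "\<P>(\<omega> in M. K \<omega> = k \<bar> N \<omega> = n)
        = real (m choose k) * (\<Sum>i\<le>k. real (k choose i) * (-1) ^ (k - i) * z i ^ n)"
      using assms(7) Occ_explicit[OF assms(1,2)] by (simp add: p_def z_def)
    then show ?thesis
      by (simp add: sum_distrib_left mult_ac)
  next
    case False
    then have "p n = 0"
      by (simp add: p_def zero_less_measure_iff)
    then show ?thesis by simp
  qed
  moreover have "(\<lambda>n. p n * \<P>(\<omega> in M. K \<omega> = k \<bar> N \<omega> = n)) sums \<P>(\<omega> in M. K \<omega> = k)"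
    unfolding p_def by (rule total_probability_sums) measurable
  ultimately show "\<P>(\<omega> in M. K \<omega> = k) =
      real (m choose k) * (\<Sum>i\<le>k. real (k choose i) * (-1) ^ (k - i) *
        prob_gen_fun M N (1 - \<theta> * ((real m - real i) / real m)))"
    by (simp add: z_def sums_unique2)
qed

end
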